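(* Let $R$ be a commutative ring with unity, $\Lambda$ a totally ordered abelian group, $\Lambda'$ any submonoid of $\Lambda_\infty=\Lambda\cup\{\infty\}$, and $\mathfrak{U}$ a topology on $\Lambda'$ such that (P1) the addition $+:\Lambda'\times\Lambda'\to\Lambda'$ is continuous, and (P2) for every $\gamma,\gamma'\in\Lambda'$ with $\gamma<\gamma'$ there exist open sets $U,U'\in\mathfrak{U}$ such that $\gamma\in U$, $\gamma'\in U'$ and $U<U'$ (i.e. $u<u'$ for every $u\in U$ and $u'\in U'$). Then the set $\mathcal{V}_R(\Lambda')$ of valuations of $R$ taking values in $\Lambda'$ is closed in $(\Lambda')^R$ (with the product topology induced by $\mathfrak{U}$).
   Context: $\Lambda_\infty=\Lambda\cup\{\infty\}$ with $\gamma+\infty=\infty+\gamma=\infty$ for all $\gamma\in\Lambda_\infty$ and $\gamma<\infty$ for all $\gamma\in\Lambda$. A valuation on $R$ is a map $\nu:R\to\Lambda_\infty$ with $\nu(ab)=\nu(a)+\nu(b)$ and $\nu(a+b)\geq\min\{\nu(a),\nu(b)\}$ for all $a,b\in R$, $\nu(1)=0$ and $\nu(0)=\infty$. $\mathcal{V}_R(\Lambda')$ is the set of valuations $\nu$ on $R$ with $\nu(a)\in\Lambda'$ for all $a\in R$, regarded as a subset of $(\Lambda')^R$, the set of all maps $R\to\Lambda'$. *)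

theory Defs
  imports "HOL-Analysis.Analysis"
begin

datatype 'a with_infty = Fin 'a | Infty

instantiation with_infty :: (linorder) linorder
begin

fun less_eq_with_infty :: "'a with_infty \<Rightarrow> 'a with_infty \<Rightarrow> bool" where
  "Fin a \<le> Fin b \<longleftrightarrow> a \<le> b"
| "x \<le> Infty \<longleftrightarrow> True"
| "Infty \<le> Fin b \<longleftrightarrow> False"

fun less_with_infty :: "'a with_infty \<Rightarrow> 'a with_infty \<Rightarrow> bool" where
  "Fin a < Fin b \<longleftrightarrow> a < b"
| "Fin a < Infty \<longleftrightarrow> True"
| "Infty < x \<longleftrightarrow> False"

instance
proof
  fix x y z :: "'a with_infty"
  show "x < y \<longleftrightarrow> x \<le> y \<and> \<not> y \<le> x"
    by (cases x; cases y) auto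
  show "x \<le> x"
    by (cases x) auto
  show "x \<le> y \<Longrightarrow> y \<le> z \<Longrightarrow> x \<le> z"
    by (cases x; cases y; cases z) auto
  show "x \<le> y \<Longrightarrow> y \<le> x \<Longrightarrow> x = y"
    by (cases x; cases y) auto
  show "x \<le> y \<or> y \<le> x"
    by (cases x; cases y) auto
qed

end

instantiation with_infty :: (comm_monoid_add) comm_monoid_add
begin

definition zero_with_infty :: "'a with_infty" where
  "0 = Fin 0"

fun plus_with_infty :: "'a with_infty \<Rightarrow> 'a with_infty \<Rightarrow> 'a with_infty" where
  "Fin a + Fin b = Fin (a + b)"
| "Infty + x = Infty"
| "Fin a + Infty = Infty"

instance
proof
  fix x y z :: "'a with_infty"
  show "x + y + z = x + (y + z)"
    by (cases x; cases y; cases z) (auto simp: add.assoc)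
  show "x + y = y + x"
    by (cases x; cases y) (auto simp: add.commute)
  show "0 + x = x"
    by (cases x) (auto simp: zero_with_infty_def)
qed

end

text \<open>The sort \<open>{comm_ring, comm_monoid_mult}\<close> describes the commutative rings with unity;
  unlike \<open>comm_ring_1\<close> it does not exclude the zero ring.\<close>

definition is_valuation ::
    "('r::{comm_ring, comm_monoid_mult} \<Rightarrow> 'g::linordered_ab_group_add with_infty) \<Rightarrow> bool" where
  "is_valuation \<nu> \<longleftrightarrow>
     (\<forall>a b. \<nu> (a * b) = \<nu> a + \<nu> b) \<and>
     (\<forall>a b. \<nu> (a + b) \<ge> min (\<nu> a) (\<nu> b)) \<and>
     \<nu> 1 = 0 \<and>
     \<nu> 0 = Infty"

definition valuations_in ::
    "'g::linordered_ab_group_add with_infty set \<Rightarrow>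
     ('r::{comm_ring, comm_monoid_mult} \<Rightarrow> 'g with_infty) set" where
  "valuations_in L = {\<nu>. is_valuation \<nu> \<and> (\<forall>a. \<nu> a \<in> L)}"

definition is_submonoid :: "'m::comm_monoid_add set \<Rightarrow> bool" where
  "is_submonoid M \<longleftrightarrow> 0 \<in> M \<and> (\<forall>x\<in>M. \<forall>y\<in>M. x + y \<in> M)"

end

theory Submission
  imports Defs
begin

text \<open>Each valuation axiom is a closed condition on finitely many evaluations: (P2) makes the
  target Hausdorff and the order relation closed, and \<open>min x y \<le> z\<close> is the union of the
  closed conditions \<open>x \<le> z\<close> and \<open>y \<le> z\<close>, so continuity of \<open>min\<close> is not needed.\<close>

locale order_separated_topology =
  fixes T :: "'a::linorder topology"
  assumes separation: "\<And>x y. x \<in> topspace T \<Longrightarrow> y \<in> topspace T \<Longrightarrow> x < y \<Longrightarrow>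
      \<exists>U V. openin T U \<and> openin T V \<and> x \<in> U \<and> y \<in> V \<and> (\<forall>u\<in>U. \<forall>v\<in>V. u < v)"
begin

text \<open>Of two distinct points one is smaller, and sets with \<open>u < v\<close> throughout
  cannot meet; disjointness is symmetric, so the smaller point may be taken first.\<close>

lemma Hausdorff: "Hausdorff_space T"
  unfolding Hausdorff_space_def
proof (intro allI impI, elim conjE)
  fix x y
  assume "x \<in> topspace T" "y \<in> topspace T" "x \<noteq> y"
  then show "\<exists>U V. openin T U \<and> openin T V \<and> x \<in> U \<and> y \<in> V \<and> disjnt U V"
  proof (induction x y rule: linorder_wlog)
    case (le x y)
    then have "x < y"
      by simp
    then obtain U V where "openin T U" "openin T V" "x \<in> U" "y \<in> V" "\<forall>u\<in>U. \<forall>v\<in>V. u < v"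
      using separation le by metis
    moreover from this have "disjnt U V"
      by (auto simp: disjnt_iff)
    ultimately show ?case
      by blast
  next
    case (sym x y)
    then show ?case
      by (metis disjnt_sym)
  qed
qed

text \<open>The complement is open: if \<open>g x < f x\<close>, separate the two values by
  \<open>U\<close> and \<open>V\<close>; wherever \<open>g\<close> stays in \<open>U\<close> and
  \<open>f\<close> in \<open>V\<close>, the strict inequality persists.\<close>

lemma closedin_le:
  assumes f: "continuous_map X T f" and g: "continuous_map X T g"
  shows "closedin X {x \<in> topspace X. f x \<le> g x}"
proof -
  have "openin X {x \<in> topspace X. g x < f x}"
  proof (subst openin_subopen, clarify)
    fix x
    assume x: "x \<in> topspace X" "g x < f x"
    then have "g x \<in> topspace T" "f x \<in> topspace T"
      using f g by (auto simp: continuous_map_def)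
    then obtain U V where UV: "openin T U" "openin T V" "g x \<in> U" "f x \<in> V"
        "\<forall>u\<in>U. \<forall>v\<in>V. u < v"
      using separation x(2) by metis
    let ?W = "{y \<in> topspace X. g y \<in> U} \<inter> {y \<in> topspace X. f y \<in> V}"
    have "openin X ?W"
      using f g UV by (intro openin_Int openin_continuous_map_preimage)
    moreover have "x \<in> ?W" "?W \<subseteq> {x \<in> topspace X. g x < f x}"
      using UV x by auto
    ultimately show "\<exists>W. openin X W \<and> x \<in> W \<and> W \<subseteq> {x \<in> topspace X. g x < f x}"
      by blast
  qed
  moreover have "topspace X - {x \<in> topspace X. f x \<le> g x} = {x \<in> topspace X. g x < f x}"
    by auto
  ultimately show ?thesis
    by (simp add: closedin_def)
qed

lemma closedin_min_le:
  assumes "continuous_map X T f" "continuous_map X T g" "continuous_map X T h"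
  shows "closedin X {x \<in> topspace X. min (f x) (g x) \<le> h x}"
proof -
  have "{x \<in> topspace X. min (f x) (g x) \<le> h x} =
      {x \<in> topspace X. f x \<le> h x} \<union> {x \<in> topspace X. g x \<le> h x}"
    by (auto simp: min_le_iff_disj)
  then show ?thesis
    using assms by (simp add: closedin_Un closedin_le)
qed

text \<open>The constant may lie outside the space, as \<open>Infty\<close> may lie outside \<open>\<Lambda>'\<close>.\<close>
lemma closedin_eq_const:
  assumes "continuous_map X T f"
  shows "closedin X {x \<in> topspace X. f x = c}"
proof (cases "c \<in> topspace T")
  case True
  then show ?thesis
    using assms by (intro closedin_continuous_maps_eq[OF Hausdorff]) auto
next
  \<comment> \<open>A continuous map takes its values in \<open>topspace T\<close>, so the level set
    of an outside point is empty.\<close>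
  case False
  then have "{x \<in> topspace X. f x = c} = {}"
    using assms by (auto simp: continuous_map_def)
  then show ?thesis
    by (simp only: closedin_empty)
qed

end

theorem mainTheorem3:
  fixes L :: "'g::linordered_ab_group_add with_infty set"
    and \<UU> :: "'g with_infty topology"
  assumes submonoid: "is_submonoid L"
    and topology_on: "topspace \<UU> = L"
    and P1: "continuous_map (prod_topology \<UU> \<UU>) \<UU> (\<lambda>(x, y). x + y)"
    and P2: "\<And>\<gamma> \<gamma>'. \<gamma> \<in> L \<Longrightarrow> \<gamma>' \<in> L \<Longrightarrow> \<gamma> < \<gamma>' \<Longrightarrow>
      \<exists>U U'. openin \<UU> U \<and> openin \<UU> U' \<and> \<gamma> \<in> U \<and> \<gamma>' \<in> U' \<and> (\<forall>u\<in>U. \<forall>u'\<in>U'. u < u')"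
  shows "closedin (product_topology (\<lambda>_::'r::{comm_ring, comm_monoid_mult}. \<UU>) UNIV)
    (valuations_in L :: ('r \<Rightarrow> 'g with_infty) set)"
proof -
  interpret order_separated_topology \<UU>
    using P2 by unfold_locales (simp add: topology_on)
  let ?X = "product_topology (\<lambda>_::'r. \<UU>) UNIV"
  have eval: "continuous_map ?X \<UU> (\<lambda>\<nu>. \<nu> a)" for a
    by (rule continuous_map_product_projection) simp
  \<comment> \<open>(P1) enters here: a sum of two evaluations is their pairing followed by
    addition. This makes both sides of the multiplicativity axiom continuous in
    \<open>\<nu>\<close>.\<close>
  have add: "continuous_map ?X \<UU> (\<lambda>\<nu>. \<nu> a + \<nu> b)" for a b
  proof -
    have "continuous_map ?X (prod_topology \<UU> \<UU>) (\<lambda>\<nu>. (\<nu> a, \<nu> b))"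
      by (intro continuous_map_pairedI eval)
    from continuous_map_compose[OF this P1] show ?thesis
      by (simp add: o_def)
  qed
  \<comment> \<open>One set for each instance of an axiom: \<open>M\<close> for products,
    \<open>A\<close> for sums, \<open>N\<close> for the prescribed values at 1 and 0.\<close>
  define M where "M a b = {\<nu> \<in> topspace ?X. \<nu> (a * b) = \<nu> a + \<nu> b}" for a b :: 'r
  define A where "A a b = {\<nu> \<in> topspace ?X. min (\<nu> a) (\<nu> b) \<le> \<nu> (a + b)}" for a b :: 'r
  define N where "N a c = {\<nu> \<in> topspace ?X. \<nu> a = c}" for a :: 'r and c
  have "closedin ?X (M a b)" "closedin ?X (A a b)" "closedin ?X (N a c)" for a b c
    unfolding M_def A_def N_def
    by (intro closedin_continuous_maps_eq[OF Hausdorff] closedin_min_le closedin_eq_const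
        eval add)+
  \<comment> \<open>The families are indexed by all of \<open>'r\<close>, which is nonempty, so
    their intersections stay inside the space and are closed.\<close>
  then have "closedin ?X ((\<Inter>a. \<Inter>b. M a b) \<inter> (\<Inter>a. \<Inter>b. A a b) \<inter> (N 1 0 \<inter> N 0 Infty))"
    by (intro closedin_Int closedin_INT) auto
  \<comment> \<open>Membership in \<open>topspace ?X\<close> says exactly that all values lie in
    \<open>L\<close>: over \<open>UNIV\<close> the extensionality condition of \<open>PiE\<close> is
    vacuous.\<close>
  also have "(\<Inter>a. \<Inter>b. M a b) \<inter> (\<Inter>a. \<Inter>b. A a b) \<inter> (N 1 0 \<inter> N 0 Infty) = valuations_in L"
    by (auto simp: M_def A_def N_def valuations_in_def is_valuation_def topology_on PiE_iff)
  finally show ?thesis .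
qed

end
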